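(* The bi-level binary program (BL) is a valid formulation for the team formation problem (TFP), where (BL) is the following. The leader chooses $x=(x_{i,k})_{i\in\mathcal N,k\in\mathcal M}$ to solve $$\max\ \alpha\sum_{i\in\mathcal N}\sum_{j\in\mathcal N}\sum_{k\in\mathcal M}u_{i,j}\,x_{i,k}x_{j,k}-(1-\alpha)\,r$$ subject to $$\sum_{i\in\mathcal N}x_{i,k}=s\ \ \forall k\in\mathcal M,\qquad \sum_{k\in\mathcal M}x_{i,k}=1\ \ \forall i\in\mathcal N,\qquad x_{i,k}\in\{0,1\}\ \ \forall i\in\mathcal N,k\in\mathcal M,$$ and $r$ equal to the optimal value of the follower problem (in the variables $y=(y_i)_{i\in\mathcal N}$, with $x$ fixed) $$r=\max\ \sum_{i\in\mathcal N}\sum_{j\in\mathcal N}u_{i,j}y_iy_j-\sum_{i\in\mathcal N}\sum_{j\in\mathcal N}\sum_{k\in\mathcal M}y_i\,u_{i,j}\,x_{i,k}x_{j,k}$$ subject to $$0\le(1-y_i)\,\mathcal U(i)+\sum_{j\in\mathcal N}u_{i,j}y_iy_j-\sum_{j\in\mathcal N}\sum_{k\in\mathcal M}y_i\,u_{i,j}\,x_{i,k}x_{j,k}\ \ \forall i\in\mathcal N,\qquad \sum_{i\in\mathcal N}y_i=s,\qquad y_i\in\{0,1\}\ \ \forall i\in\mathcal N.$$ That is: the feasible leader solutions $x$ are exactly the vectors given by $x_{i,k}=1\Leftrightarrow \mathsf t(i)=k$ for $\mathsf t\in\mathcal T$, and for each such corresponding pair $(x,\mathsf t)$ the follower's optimal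 value equals the maximum uplift of $\mathsf t$ and the leader's objective value at $x$ equals the (TFP) objective value of $\mathsf t$.
   Context: Let $n,m,s$ be positive integers with $n=ms$, $\mathcal N=\{1,\dots,n\}$ (agents), $\mathcal M=\{1,\dots,m\}$ (teams). For $i,j\in\mathcal N$, $u_{i,j}$ is a nonnegative integer (pairwise utility of $i$ for being teamed with $j$), with $u_{i,i}=0$; $u$ need not be symmetric. Let $\alpha\in[0,1]$. A team formation is a map $\mathsf t:\mathcal N\to\mathcal M$ with $|\{i:\mathsf t(i)=k\}|=s$ for every $k\in\mathcal M$; $\mathcal T$ is the set of all team formations. Let $\mathsf c(\mathsf t,i)=\{j:\mathsf t(j)=\mathsf t(i)\}$. Let $\mathcal C$ be the family of all $s$-element subsets of $\mathcal N$ (coalitions) and $\mathcal C(i)=\{c\in\mathcal C:i\in c\}$. For $c\in\mathcal C(i)$ put $\mathsf u(c,i)=\sum_{j\in c}u_{i,j}$; put $\mathsf u(\mathsf t,i)=\mathsf u(\mathsf c(\mathsf t,i),i)$ and $\mathcal U(i)=\max_{c\in\mathcal C(i)}\mathsf u(c,i)$. For $\mathsf t\in\mathcal T$ and $c\in\mathcal C$ let $r(c,\mathsf t)=\sum_{i\in c}(\mathsf u(c,i)-\mathsf u(\mathsf t,i))$. The maximum uplift of $\mathsf t$ is $\max\{r(c,\mathsf t): c\in\mathcal C,\ \mathsf u(c,i)\ge\mathsf u(\mathsf t,i)\text{ for all }i\in c\}$. The team formation problem (TFP) is $$\max_{\mathsf t\in\mathcal T}\ \alpha\sum_{i\in\mathcal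 N}\mathsf u(\mathsf t,i)-(1-\alpha)\,r,\qquad r=\text{the maximum uplift of }\mathsf t.$$ *)

theory Defs
  imports Complex_Main "HOL-Library.FuncSet"
begin

text \<open>
  Agents are \<open>{1..n}\<close>, teams are \<open>{1..m}\<close>. Maps and vectors indexed by these sets are
  extensional functions, so that equality of functions is equality of the indexed families.
\<close>

definition team_formations :: "nat \<Rightarrow> nat \<Rightarrow> nat \<Rightarrow> (nat \<Rightarrow> nat) set" where
  "team_formations n m s =
     {t \<in> {1..n} \<rightarrow>\<^sub>E {1..m}. \<forall>k\<in>{1..m}. card {i \<in> {1..n}. t i = k} = s}"

definition coalition_of :: "nat \<Rightarrow> (nat \<Rightarrow> nat) \<Rightarrow> nat \<Rightarrow> nat set" where
  "coalition_of n t i = {j \<in> {1..n}. t j = t i}"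

definition coalitions :: "nat \<Rightarrow> nat \<Rightarrow> nat set set" where
  "coalitions n s = {c. c \<subseteq> {1..n} \<and> card c = s}"

definition coalitions_with :: "nat \<Rightarrow> nat \<Rightarrow> nat \<Rightarrow> nat set set" where
  "coalitions_with n s i = {c \<in> coalitions n s. i \<in> c}"

definition coalition_utility :: "(nat \<Rightarrow> nat \<Rightarrow> nat) \<Rightarrow> nat set \<Rightarrow> nat \<Rightarrow> nat" where
  "coalition_utility u c i = (\<Sum>j\<in>c. u i j)"

definition utility :: "nat \<Rightarrow> (nat \<Rightarrow> nat \<Rightarrow> nat) \<Rightarrow> (nat \<Rightarrow> nat) \<Rightarrow> nat \<Rightarrow> nat" where
  "utility n u t i = coalition_utility u (coalition_of n t i) i"

definition max_utility :: "nat \<Rightarrow> nat \<Rightarrow> (nat \<Rightarrow> nat \<Rightarrow> nat) \<Rightarrow> nat \<Rightarrow> nat" where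
  "max_utility n s u i = Max ((\<lambda>c. coalition_utility u c i) ` coalitions_with n s i)"

definition uplift :: "nat \<Rightarrow> (nat \<Rightarrow> nat \<Rightarrow> nat) \<Rightarrow> nat set \<Rightarrow> (nat \<Rightarrow> nat) \<Rightarrow> real" where
  "uplift n u c t = (\<Sum>i\<in>c. real (coalition_utility u c i) - real (utility n u t i))"

definition uplift_coalitions ::
    "nat \<Rightarrow> nat \<Rightarrow> (nat \<Rightarrow> nat \<Rightarrow> nat) \<Rightarrow> (nat \<Rightarrow> nat) \<Rightarrow> nat set set" where
  "uplift_coalitions n s u t =
     {c \<in> coalitions n s. \<forall>i\<in>c. coalition_utility u c i \<ge> utility n u t i}"

definition maximum_uplift ::
    "nat \<Rightarrow> nat \<Rightarrow> (nat \<Rightarrow> nat \<Rightarrow> nat) \<Rightarrow> (nat \<Rightarrow> nat) \<Rightarrow> real" where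
  "maximum_uplift n s u t = Max ((\<lambda>c. uplift n u c t) ` uplift_coalitions n s u t)"

definition tfp_objective ::
    "nat \<Rightarrow> nat \<Rightarrow> (nat \<Rightarrow> nat \<Rightarrow> nat) \<Rightarrow> real \<Rightarrow> (nat \<Rightarrow> nat) \<Rightarrow> real" where
  "tfp_objective n s u \<alpha> t =
     \<alpha> * (\<Sum>i\<in>{1..n}. real (utility n u t i)) - (1 - \<alpha>) * maximum_uplift n s u t"

definition leader_feasible :: "nat \<Rightarrow> nat \<Rightarrow> nat \<Rightarrow> (nat \<Rightarrow> nat \<Rightarrow> real) set" where
  "leader_feasible n m s =
     {x \<in> {1..n} \<rightarrow>\<^sub>E ({1..m} \<rightarrow>\<^sub>E {0, 1}).
        (\<forall>k\<in>{1..m}. (\<Sum>i\<in>{1..n}. x i k) = real s) \<and>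
        (\<forall>i\<in>{1..n}. (\<Sum>k\<in>{1..m}. x i k) = 1)}"

definition follower_feasible ::
    "nat \<Rightarrow> nat \<Rightarrow> nat \<Rightarrow> (nat \<Rightarrow> nat \<Rightarrow> nat) \<Rightarrow> (nat \<Rightarrow> nat \<Rightarrow> real) \<Rightarrow> (nat \<Rightarrow> real) set" where
  "follower_feasible n m s u x =
     {y \<in> {1..n} \<rightarrow>\<^sub>E {0, 1}.
        (\<forall>i\<in>{1..n}. 0 \<le> (1 - y i) * real (max_utility n s u i)
             + (\<Sum>j\<in>{1..n}. real (u i j) * y i * y j)
             - (\<Sum>j\<in>{1..n}. \<Sum>k\<in>{1..m}. y i * real (u i j) * x i k * x j k)) \<and>
        (\<Sum>i\<in>{1..n}. y i) = real s}"

definition follower_objective ::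
    "nat \<Rightarrow> nat \<Rightarrow> (nat \<Rightarrow> nat \<Rightarrow> nat) \<Rightarrow> (nat \<Rightarrow> nat \<Rightarrow> real) \<Rightarrow> (nat \<Rightarrow> real) \<Rightarrow> real" where
  "follower_objective n m u x y =
     (\<Sum>i\<in>{1..n}. \<Sum>j\<in>{1..n}. real (u i j) * y i * y j)
     - (\<Sum>i\<in>{1..n}. \<Sum>j\<in>{1..n}. \<Sum>k\<in>{1..m}. y i * real (u i j) * x i k * x j k)"

definition follower_value ::
    "nat \<Rightarrow> nat \<Rightarrow> nat \<Rightarrow> (nat \<Rightarrow> nat \<Rightarrow> nat) \<Rightarrow> (nat \<Rightarrow> nat \<Rightarrow> real) \<Rightarrow> real" where
  "follower_value n m s u x = Max (follower_objective n m u x ` follower_feasible n m s u x)"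

text \<open>The variable \<open>r\<close> of the leader is determined by \<open>x\<close>, and is substituted here.\<close>

definition leader_objective ::
    "nat \<Rightarrow> nat \<Rightarrow> nat \<Rightarrow> (nat \<Rightarrow> nat \<Rightarrow> nat) \<Rightarrow> real \<Rightarrow> (nat \<Rightarrow> nat \<Rightarrow> real) \<Rightarrow> real" where
  "leader_objective n m s u \<alpha> x =
     \<alpha> * (\<Sum>i\<in>{1..n}. \<Sum>j\<in>{1..n}. \<Sum>k\<in>{1..m}. real (u i j) * x i k * x j k)
     - (1 - \<alpha>) * follower_value n m s u x"

definition assignment_vector :: "nat \<Rightarrow> nat \<Rightarrow> (nat \<Rightarrow> nat) \<Rightarrow> nat \<Rightarrow> nat \<Rightarrow> real" where
  "assignment_vector n m t = (\<lambda>i\<in>{1..n}. \<lambda>k\<in>{1..m}. if t i = k then 1 else 0)"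

end

theory Submission
  imports Defs
begin

text \<open>
  A vector with entries 0 and 1 is the indicator of a set, and its sum is the size of that set. So
  the rows of a feasible leader vector are indicators of single teams, and the vectors \<open>y\<close> of the
  follower with sum \<open>s\<close> are the indicators of coalitions. The product of the entries of agents
  \<open>i\<close> and \<open>j\<close> summed over the teams indicates whether both are in the same team, which turns the
  double sums into utilities. In the constraint of the follower for agent \<open>i\<close>, the case \<open>y\<^sub>i = 1\<close> is
  the condition that \<open>i\<close> does not lose by joining, and the case \<open>y\<^sub>i = 0\<close> is void.
\<close>

lemma sum_zero_one_eq_card:
  fixes f :: "'a \<Rightarrow> 'b::semiring_1"
  assumes "finite A" and "\<And>a. a \<in> A \<Longrightarrow> f a \<in> {0, 1}"
  shows "sum f A = of_nat (card {a \<in> A. f a = 1})"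
proof -
  have "sum f A = (\<Sum>a\<in>A. if f a = 1 then 1 else 0)"
    using assms(2) by (intro sum.cong) auto
  then show ?thesis
    using assms(1) by (simp add: sum.If_cases Int_def)
qed

lemma is_arg_max_bij_betw_iff:
  assumes "bij_betw f A B" and "\<And>a. a \<in> A \<Longrightarrow> g (f a) = h a" and "a \<in> A"
  shows "is_arg_max g (\<lambda>b. b \<in> B) (f a) \<longleftrightarrow> is_arg_max h (\<lambda>a. a \<in> A) a"
proof -
  have "B = f ` A"
    using assms(1) by (simp add: bij_betw_def)
  then show ?thesis
    using assms(2,3) by (auto simp: is_arg_max_def)
qed

section \<open>Team formations as leader vectors\<close>

lemma team_formations_range:
  "t \<in> team_formations n m s \<Longrightarrow> i \<in> {1..n} \<Longrightarrow> t i \<in> {1..m}"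
  by (auto simp: team_formations_def)

lemma assignment_vector_apply:
  "i \<in> {1..n} \<Longrightarrow> k \<in> {1..m} \<Longrightarrow>
    assignment_vector n m t i k = (if t i = k then 1 else 0)"
  by (simp add: assignment_vector_def)

lemma inj_on_assignment_vector:
  "inj_on (assignment_vector n m) (team_formations n m s)"
proof (rule inj_onI)
  fix t t'
  assume t: "t \<in> team_formations n m s" and t': "t' \<in> team_formations n m s"
    and eq: "assignment_vector n m t = assignment_vector n m t'"
  show "t = t'"
  proof (rule PiE_ext)
    show "t \<in> {1..n} \<rightarrow>\<^sub>E {1..m}" "t' \<in> {1..n} \<rightarrow>\<^sub>E {1..m}"
      using t t' by (auto simp: team_formations_def)
  next
    fix i assume i: "i \<in> {1..n}"
    then have "assignment_vector n m t' i (t i) = 1"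
      using team_formations_range[OF t i] by (simp add: eq[symmetric] assignment_vector_apply)
    then show "t i = t' i"
      using i team_formations_range[OF t i] by (auto simp: assignment_vector_apply split: if_splits)
  qed
qed

lemma assignment_vector_feasible:
  assumes t: "t \<in> team_formations n m s"
  shows "assignment_vector n m t \<in> leader_feasible n m s"
proof -
  have "(\<Sum>i\<in>{1..n}. assignment_vector n m t i k) = real s" if k: "k \<in> {1..m}" for k
  proof -
    have "(\<Sum>i\<in>{1..n}. assignment_vector n m t i k) = (\<Sum>i\<in>{1..n}. if t i = k then 1 else 0)"
      using k by (intro sum.cong) (auto simp: assignment_vector_apply)
    also have "\<dots> = real (card {i \<in> {1..n}. t i = k})"
      by (simp add: sum.If_cases Int_def)
    finally show ?thesis
      using t k by (simp add: team_formations_def)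
  qed
  moreover have "(\<Sum>k\<in>{1..m}. assignment_vector n m t i k) = 1" if i: "i \<in> {1..n}" for i
  proof -
    have "(\<Sum>k\<in>{1..m}. assignment_vector n m t i k) = (\<Sum>k\<in>{1..m}. if t i = k then 1 else 0)"
      using i by (intro sum.cong) (auto simp: assignment_vector_apply)
    then show ?thesis
      using team_formations_range[OF t i] by simp
  qed
  ultimately show ?thesis
    by (auto simp: leader_feasible_def assignment_vector_def)
qed

lemma leader_feasible_imp_assignment_vector:
  assumes x: "x \<in> leader_feasible n m s"
  obtains t where "t \<in> team_formations n m s" and "assignment_vector n m t = x"
proof -
  have x_ext: "x \<in> {1..n} \<rightarrow>\<^sub>E ({1..m} \<rightarrow>\<^sub>E {0, 1})"
    using x by (simp add: leader_feasible_def)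
  have x01: "x i k \<in> {0, 1}" if "i \<in> {1..n}" "k \<in> {1..m}" for i k
    using PiE_mem[OF x_ext that(1)] that(2) by (rule PiE_mem)
  have "\<exists>k. {k \<in> {1..m}. x i k = 1} = {k}" if i: "i \<in> {1..n}" for i
  proof -
    have "(\<Sum>k\<in>{1..m}. x i k) = real (card {k \<in> {1..m}. x i k = 1})"
      using x01[OF i] by (intro sum_zero_one_eq_card) auto
    then have "card {k \<in> {1..m}. x i k = 1} = 1"
      using x i by (simp add: leader_feasible_def)
    then show ?thesis
      by (auto simp: card_1_singleton_iff)
  qed
  then obtain t0 where t0: "\<And>i. i \<in> {1..n} \<Longrightarrow> {k \<in> {1..m}. x i k = 1} = {t0 i}"
    by metis
  define t where "t = restrict t0 {1..n}"
  have mem_iff: "k \<in> {1..m} \<and> x i k = 1 \<longleftrightarrow> k = t i" if "i \<in> {1..n}" for i k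
  proof -
    have "k \<in> {k \<in> {1..m}. x i k = 1} \<longleftrightarrow> k \<in> {t0 i}"
      by (simp only: t0[OF that])
    then show ?thesis
      using that by (simp add: t_def)
  qed
  have t_range: "t i \<in> {1..m}" if "i \<in> {1..n}" for i
    using mem_iff[OF that, of "t i"] by simp
  have t_iff: "x i k = 1 \<longleftrightarrow> t i = k" if "i \<in> {1..n}" "k \<in> {1..m}" for i k
    using mem_iff[OF that(1), of k] that(2) by auto
  show thesis
  proof (rule that)
    have "card {i \<in> {1..n}. t i = k} = s" if k: "k \<in> {1..m}" for k
    proof -
      have "{i \<in> {1..n}. t i = k} = {i \<in> {1..n}. x i k = 1}"
        using t_iff k by blast
      moreover have "(\<Sum>i\<in>{1..n}. x i k) = real (card {i \<in> {1..n}. x i k = 1})"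
        using x01 k by (intro sum_zero_one_eq_card) auto
      ultimately show ?thesis
        using x k by (simp add: leader_feasible_def)
    qed
    then show "t \<in> team_formations n m s"
      using t_range by (auto simp: team_formations_def t_def)
  next
    show "assignment_vector n m t = x"
    proof (rule PiE_ext[OF _ x_ext])
      show "assignment_vector n m t \<in> {1..n} \<rightarrow>\<^sub>E ({1..m} \<rightarrow>\<^sub>E {0, 1})"
        by (auto simp: assignment_vector_def)
    next
      fix i assume i: "i \<in> {1..n}"
      show "assignment_vector n m t i = x i"
      proof (rule PiE_ext[OF _ PiE_mem[OF x_ext i]])
        show "assignment_vector n m t i \<in> {1..m} \<rightarrow>\<^sub>E {0, 1}"
          using i by (auto simp: assignment_vector_def)
      next
        fix k assume k: "k \<in> {1..m}"
        show "assignment_vector n m t i k = x i k"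
          using x01[OF i k] t_iff[OF i k] i k by (auto simp: assignment_vector_apply)
      qed
    qed
  qed
qed

lemma bij_betw_assignment_vector:
  "bij_betw (assignment_vector n m) (team_formations n m s) (leader_feasible n m s)"
  unfolding bij_betw_def
proof
  show "assignment_vector n m ` team_formations n m s = leader_feasible n m s"
    by (auto simp: assignment_vector_feasible elim: leader_feasible_imp_assignment_vector)
qed (rule inj_on_assignment_vector)

lemma sum_assignment_vector_eq_utility:
  assumes t: "t \<in> team_formations n m s" and i: "i \<in> {1..n}"
  shows "(\<Sum>j\<in>{1..n}. \<Sum>k\<in>{1..m}.
           real (u i j) * assignment_vector n m t i k * assignment_vector n m t j k)
         = real (utility n u t i)"
proof -
  have "(\<Sum>k\<in>{1..m}. real (u i j) * assignment_vector n m t i k * assignment_vector n m t j k)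
        = (if t j = t i then real (u i j) else 0)" if j: "j \<in> {1..n}" for j
  proof -
    have "(\<Sum>k\<in>{1..m}. real (u i j) * assignment_vector n m t i k * assignment_vector n m t j k)
          = (\<Sum>k\<in>{1..m}. if t i = k then (if t j = t i then real (u i j) else 0) else 0)"
      using i j by (intro sum.cong) (auto simp: assignment_vector_apply)
    then show ?thesis
      using team_formations_range[OF t i] by simp
  qed
  then have "(\<Sum>j\<in>{1..n}. \<Sum>k\<in>{1..m}.
           real (u i j) * assignment_vector n m t i k * assignment_vector n m t j k)
        = (\<Sum>j\<in>{1..n}. if t j = t i then real (u i j) else 0)"
    by (intro sum.cong) auto
  also have "\<dots> = real (utility n u t i)"
    by (simp add: utility_def coalition_utility_def coalition_of_def sum.If_cases Int_def)
  finally show ?thesis .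
qed

section \<open>Coalitions as follower vectors\<close>

definition coalition_vector :: "nat \<Rightarrow> nat set \<Rightarrow> nat \<Rightarrow> real" where
  "coalition_vector n c = (\<lambda>i\<in>{1..n}. if i \<in> c then 1 else 0)"

lemma coalition_vector_apply:
  "i \<in> {1..n} \<Longrightarrow> coalition_vector n c i = (if i \<in> c then 1 else 0)"
  by (simp add: coalition_vector_def)

lemma coalition_vector_image:
  "coalition_vector n ` coalitions n s = {y \<in> {1..n} \<rightarrow>\<^sub>E {0, 1}. (\<Sum>i\<in>{1..n}. y i) = real s}"
proof (intro equalityI subsetI)
  fix y assume "y \<in> coalition_vector n ` coalitions n s"
  then obtain c where c: "c \<subseteq> {1..n}" "card c = s" and y: "y = coalition_vector n c"
    by (auto simp: coalitions_def)
  have "(\<Sum>i\<in>{1..n}. y i) = (\<Sum>i\<in>{1..n}. if i \<in> c then 1 else 0)"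
    by (intro sum.cong) (auto simp: y coalition_vector_apply)
  also have "\<dots> = real s"
    using c by (simp add: sum.If_cases Int_absorb1)
  finally show "y \<in> {y \<in> {1..n} \<rightarrow>\<^sub>E {0, 1}. (\<Sum>i\<in>{1..n}. y i) = real s}"
    by (auto simp: y coalition_vector_def)
next
  fix y :: "nat \<Rightarrow> real"
  assume "y \<in> {y \<in> {1..n} \<rightarrow>\<^sub>E {0, 1}. (\<Sum>i\<in>{1..n}. y i) = real s}"
  then have y: "y \<in> {1..n} \<rightarrow>\<^sub>E {0, 1}" and sum: "(\<Sum>i\<in>{1..n}. y i) = real s"
    by auto
  let ?c = "{i \<in> {1..n}. y i = 1}"
  have "(\<Sum>i\<in>{1..n}. y i) = real (card ?c)"
    using y by (intro sum_zero_one_eq_card) auto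
  then have "?c \<in> coalitions n s"
    using sum by (auto simp: coalitions_def)
  moreover have "y = coalition_vector n ?c"
  proof (rule PiE_ext[OF y])
    show "coalition_vector n ?c \<in> {1..n} \<rightarrow>\<^sub>E {0, 1}"
      by (auto simp: coalition_vector_def)
  next
    fix i assume i: "i \<in> {1..n}"
    show "y i = coalition_vector n ?c i"
      using PiE_mem[OF y i] i by (auto simp: coalition_vector_apply)
  qed
  ultimately show "y \<in> coalition_vector n ` coalitions n s"
    by blast
qed

lemma sum_coalition_vector_eq_coalition_utility:
  assumes "c \<subseteq> {1..n}" and "i \<in> {1..n}"
  shows "(\<Sum>j\<in>{1..n}. real (u i j) * coalition_vector n c i * coalition_vector n c j)
         = (if i \<in> c then real (coalition_utility u c i) else 0)"
proof -
  have "(\<Sum>j\<in>{1..n}. real (u i j) * coalition_vector n c i * coalition_vector n c j)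
        = (\<Sum>j\<in>{1..n}. if j \<in> c then (if i \<in> c then real (u i j) else 0) else 0)"
    using assms(2) by (intro sum.cong) (auto simp: coalition_vector_apply)
  then show ?thesis
    using assms(1) by (simp add: sum.If_cases Int_absorb1 coalition_utility_def)
qed

lemma sum_coalition_assignment_vector:
  assumes "t \<in> team_formations n m s" and "i \<in> {1..n}"
  shows "(\<Sum>j\<in>{1..n}. \<Sum>k\<in>{1..m}. coalition_vector n c i * real (u i j)
            * assignment_vector n m t i k * assignment_vector n m t j k)
         = (if i \<in> c then real (utility n u t i) else 0)"
  using assms sum_assignment_vector_eq_utility[OF assms, of u]
  by (simp add: coalition_vector_apply)

lemma follower_feasible_eq_image:
  assumes t: "t \<in> team_formations n m s"
  shows "follower_feasible n m s u (assignment_vector n m t)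
         = coalition_vector n ` uplift_coalitions n s u t"
proof -
  let ?slack = "\<lambda>y i. (1 - y i) * real (max_utility n s u i)
             + (\<Sum>j\<in>{1..n}. real (u i j) * y i * y j)
             - (\<Sum>j\<in>{1..n}. \<Sum>k\<in>{1..m}. y i * real (u i j)
                  * assignment_vector n m t i k * assignment_vector n m t j k)"
  have feasible_iff: "(\<forall>i\<in>{1..n}. 0 \<le> ?slack (coalition_vector n c) i) \<longleftrightarrow>
        (\<forall>i\<in>c. coalition_utility u c i \<ge> utility n u t i)"
    if c: "c \<in> coalitions n s" for c
  proof -
    have sub: "c \<subseteq> {1..n}"
      using c by (simp add: coalitions_def)
    have "0 \<le> ?slack (coalition_vector n c) i \<longleftrightarrow>
          (i \<in> c \<longrightarrow> coalition_utility u c i \<ge> utility n u t i)" if i: "i \<in> {1..n}" for i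
      unfolding sum_coalition_vector_eq_coalition_utility[OF sub i]
        sum_coalition_assignment_vector[OF t i]
      using i by (simp add: coalition_vector_apply)
    then show ?thesis
      using sub by blast
  qed
  have "follower_feasible n m s u (assignment_vector n m t)
      = {y \<in> coalition_vector n ` coalitions n s. \<forall>i\<in>{1..n}. 0 \<le> ?slack y i}"
    unfolding coalition_vector_image follower_feasible_def by blast
  also have "\<dots> = coalition_vector n ` {c \<in> coalitions n s.
      \<forall>i\<in>{1..n}. 0 \<le> ?slack (coalition_vector n c) i}"
    by blast
  also have "\<dots> = coalition_vector n ` uplift_coalitions n s u t"
    unfolding uplift_coalitions_def by (intro arg_cong[where f = "image _"] Collect_cong)
      (use feasible_iff in blast)
  finally show ?thesis .
qed

lemma follower_objective_eq_uplift:
  assumes t: "t \<in> team_formations n m s" and c: "c \<subseteq> {1..n}"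
  shows "follower_objective n m u (assignment_vector n m t) (coalition_vector n c)
         = uplift n u c t"
proof -
  have "follower_objective n m u (assignment_vector n m t) (coalition_vector n c)
      = (\<Sum>i\<in>{1..n}. if i \<in> c then real (coalition_utility u c i) else 0)
        - (\<Sum>i\<in>{1..n}. if i \<in> c then real (utility n u t i) else 0)"
    unfolding follower_objective_def
    using sum_coalition_vector_eq_coalition_utility[OF c] sum_coalition_assignment_vector[OF t]
    by (intro arg_cong2[where f = "(-)"] sum.cong) auto
  then show ?thesis
    using c by (simp add: uplift_def sum.If_cases Int_absorb1 sum_subtractf)
qed

lemma follower_value_eq_maximum_uplift:
  assumes "t \<in> team_formations n m s"
  shows "follower_value n m s u (assignment_vector n m t) = maximum_uplift n s u t"
proof -
  have "follower_objective n m u (assignment_vector n m t) (coalition_vector n c) = uplift n u c t"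
    if "c \<in> uplift_coalitions n s u t" for c
    using that by (intro follower_objective_eq_uplift[OF assms])
      (auto simp: uplift_coalitions_def coalitions_def)
  then show ?thesis
    unfolding follower_value_def maximum_uplift_def follower_feasible_eq_image[OF assms] image_image
    by (simp cong: image_cong)
qed

lemma uplift_coalitions_nonempty:
  assumes t: "t \<in> team_formations n m s" and "m > 0"
  shows "uplift_coalitions n s u t \<noteq> {}"
proof -
  let ?c = "{i \<in> {1..n}. t i = 1}"
  have "?c \<in> coalitions n s"
    using assms by (auto simp: coalitions_def team_formations_def)
  moreover have "coalition_of n t i = ?c" if "i \<in> ?c" for i
    using that by (auto simp: coalition_of_def)
  ultimately have "?c \<in> uplift_coalitions n s u t"
    by (simp add: uplift_coalitions_def utility_def)
  then show ?thesis
    by blast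
qed

lemma leader_objective_eq_tfp_objective:
  assumes "t \<in> team_formations n m s"
  shows "leader_objective n m s u \<alpha> (assignment_vector n m t) = tfp_objective n s u \<alpha> t"
  unfolding leader_objective_def tfp_objective_def follower_value_eq_maximum_uplift[OF assms]
  using sum_assignment_vector_eq_utility[OF assms]
  by (intro arg_cong2[where f = "(-)"] arg_cong2[where f = "(*)"] sum.cong refl)

theorem proposition1:
  fixes n m s :: nat and u :: "nat \<Rightarrow> nat \<Rightarrow> nat" and \<alpha> :: real
  assumes "n > 0" and "m > 0" and "s > 0" and "n = m * s"
    and "\<forall>i\<in>{1..n}. u i i = 0"
    and "0 \<le> \<alpha>" and "\<alpha> \<le> 1"
  shows "bij_betw (assignment_vector n m) (team_formations n m s) (leader_feasible n m s)
    \<and> (\<forall>t \<in> team_formations n m s.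
          uplift_coalitions n s u t \<noteq> {}
        \<and> follower_feasible n m s u (assignment_vector n m t) \<noteq> {}
        \<and> follower_value n m s u (assignment_vector n m t) = maximum_uplift n s u t
        \<and> leader_objective n m s u \<alpha> (assignment_vector n m t) = tfp_objective n s u \<alpha> t
        \<and> (is_arg_max (leader_objective n m s u \<alpha>) (\<lambda>x. x \<in> leader_feasible n m s)
              (assignment_vector n m t)
            \<longleftrightarrow> is_arg_max (tfp_objective n s u \<alpha>) (\<lambda>t'. t' \<in> team_formations n m s) t))"
proof (intro conjI ballI)
  show "bij_betw (assignment_vector n m) (team_formations n m s) (leader_feasible n m s)"
    by (rule bij_betw_assignment_vector)
next
  fix t assume t: "t \<in> team_formations n m s"
  show "uplift_coalitions n s u t \<noteq> {}"
    using t assms(2) by (rule uplift_coalitions_nonempty)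
  then show "follower_feasible n m s u (assignment_vector n m t) \<noteq> {}"
    by (simp add: follower_feasible_eq_image[OF t])
  show "follower_value n m s u (assignment_vector n m t) = maximum_uplift n s u t"
    using t by (rule follower_value_eq_maximum_uplift)
  show "leader_objective n m s u \<alpha> (assignment_vector n m t) = tfp_objective n s u \<alpha> t"
    using t by (rule leader_objective_eq_tfp_objective)
  show "is_arg_max (leader_objective n m s u \<alpha>) (\<lambda>x. x \<in> leader_feasible n m s)
              (assignment_vector n m t)
        \<longleftrightarrow> is_arg_max (tfp_objective n s u \<alpha>) (\<lambda>t'. t' \<in> team_formations n m s) t"
    by (rule is_arg_max_bij_betw_iff[OF bij_betw_assignment_vector _ t])
      (rule leader_objective_eq_tfp_objective)
qed

end
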